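(* For fixed $r,t\in\mathbb N_0$ with $t\ge2r$, $$W^{1-\frac{2\sqrt q}{q+1},\frac1{q+1}}_{q+1}(r;t)=\binom{t}{2r}(q+1)^{-r}\left(1+O\left(\frac1{\sqrt q}\right)\right),\qquad\text{as }q\to\infty.$$
   Context: For an integer $q\ge1$, $T_{q+1}$ is the $(q+1)$-regular tree with a fixed root $x_0$ and graph distance $d$. $\Delta_{T_{q+1}}f(x)=(q+1)f(x)-\sum_{y\sim x}f(y)$ and, for real $a$ and $b\ne0$, $\Delta_{q+1}^{a,b}=b\Delta_{T_{q+1}}-aI$, acting in the space variable. $\partial_tf(t)=f(t+1)-f(t)$ and $\partial_t^2f(t)=f(t+2)-2f(t+1)+f(t)$ for $t\in\mathbb N_0$. The wave kernel $W_{q+1}^{a,b}$ is the solution of $\Delta_{q+1}^{a,b}W(x;t)+\partial_t^2W(x;t)=0$ ($x\in V(T_{q+1})$, $t\in\mathbb N_0$) with $W(x;0)=\delta_{x_0}(x)$ ($=1$ if $x=x_0$, $0$ otherwise) and $\partial_tW(x;0)=0$ for all $x$. It depends on $x$ only through $r=d(x_0,x)$ and is written $W_{q+1}^{a,b}(r;t)$. Here $a=1-\frac{2\sqrt q}{q+1}$ and $b=\frac1{q+1}$ depend on $q$, and the limit is along integers $q\to\infty$. *)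

theory Defs
  imports Complex_Main "HOL-Library.Landau_Symbols" "Graph_Theory.Graph_Theory"
begin

text \<open>
  Undirected simple graphs are symmetric loop-free pair digraphs, an edge being a pair of
  opposite arcs. In this encoding every edge is a directed cycle of length 2, so acyclicity
  only excludes cycles of length at least 3. (The constants \<open>forest\<close> and \<open>tree\<close> of the library
  speak about directed cycles and do not describe undirected trees.)
\<close>

definition regular_tree :: "nat \<Rightarrow> 'v pair_pre_digraph \<Rightarrow> bool" where
  "regular_tree k G \<longleftrightarrow>
     pair_sym_digraph G \<and> pair_loopfree_digraph G \<and>
     connected (with_proj G) \<and>
     \<not> (\<exists>p. pre_digraph.cycle (with_proj G) p \<and> 3 \<le> length p) \<and>
     (\<forall>x \<in> pverts G. finite (out_arcs (with_proj G) x) \<and> out_degree (with_proj G) x = k)"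

definition graph_dist :: "'v pair_pre_digraph \<Rightarrow> 'v \<Rightarrow> 'v \<Rightarrow> ereal" where
  "graph_dist G x y = wf_digraph.\<mu> (with_proj G) (\<lambda>_. 1) x y"

definition tree_laplacian ::
    "nat \<Rightarrow> 'v pair_pre_digraph \<Rightarrow> ('v \<Rightarrow> real) \<Rightarrow> 'v \<Rightarrow> real" where
  "tree_laplacian q G f x = (real q + 1) * f x - (\<Sum>y | (x, y) \<in> parcs G. f y)"

definition scaled_laplacian ::
    "nat \<Rightarrow> real \<Rightarrow> real \<Rightarrow> 'v pair_pre_digraph \<Rightarrow> ('v \<Rightarrow> real) \<Rightarrow> 'v \<Rightarrow> real" where
  "scaled_laplacian q a b G f x = b * tree_laplacian q G f x - a * f x"

definition diff1 :: "(nat \<Rightarrow> real) \<Rightarrow> nat \<Rightarrow> real" where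
  "diff1 g t = g (t + 1) - g t"

definition diff2 :: "(nat \<Rightarrow> real) \<Rightarrow> nat \<Rightarrow> real" where
  "diff2 g t = g (t + 2) - 2 * g (t + 1) + g t"

text \<open>
  The recursion in \<open>t\<close> determines \<open>W\<close> on \<open>pverts G\<close>; its values outside
  \<open>pverts G\<close> are irrelevant.
\<close>

definition is_wave_kernel ::
    "nat \<Rightarrow> real \<Rightarrow> real \<Rightarrow> 'v pair_pre_digraph \<Rightarrow> 'v \<Rightarrow> ('v \<Rightarrow> nat \<Rightarrow> real) \<Rightarrow> bool" where
  "is_wave_kernel q a b G x0 W \<longleftrightarrow>
     (\<forall>x \<in> pverts G. \<forall>t. scaled_laplacian q a b G (\<lambda>y. W y t) x + diff2 (W x) t = 0) \<and>
     (\<forall>x \<in> pverts G. W x 0 = (if x = x0 then 1 else 0)) \<and>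
     (\<forall>x \<in> pverts G. diff1 (W x) 0 = 0)"

end

theory Submission
  imports Defs
begin

text \<open>
  Write \<open>P\<close> for the operator that averages over the \<open>q + 1\<close> neighbours of a vertex, and put
  \<open>s = 2 \<surd>q / (q + 1)\<close>. For the given parameters the wave equation reads
  \<open>\<partial>\<^sup>2 W = (P - s) W\<close> in time. The second difference of \<open>t \<mapsto> t choose (2k)\<close> is
  \<open>t \<mapsto> t choose (2k - 2)\<close>, and for \<open>k > 0\<close> these functions vanish at times 0 and 1, so the
  wave kernel is the finite Taylor expansion
  \<open>W t = \<Sum>k. (t choose 2k) (P - s)^k \<delta>\<close>.

  All the functions \<open>(P - s)^k \<delta>\<close> are radial. At distance \<open>r\<close> they vanish for \<open>k < r\<close>, and
  for \<open>k = r\<close> the value is \<open>(q + 1)^(-r)\<close>, since just one walk of length \<open>r\<close> leads back to the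
  root. This is the leading term. For \<open>k > r\<close> the value is at most \<open>4^k q^(-(k + r)/2)\<close>
  (lemma \<open>radial_power_bound\<close>): a step towards the root costs a factor \<open>1/q\<close>, a step away from
  it and the shift by \<open>s\<close> cost a factor of order 1 and \<open>q^(-1/2)\<close>, and the weight
  \<open>q^(-(k + r)/2)\<close> is the one for which all three transitions contribute the same power of \<open>q\<close>.
  Relative to the leading term, the summands with \<open>k > r\<close> are thus \<open>O(q^(-(k - r)/2))\<close>, which is
  \<open>O(q^(-1/2))\<close>.

  That radial functions stay radial under \<open>P\<close> is where the tree enters. In a graph without
  cycles of length at least 3 two vertices are joined by at most one simple path
  (lemma \<open>apath_unique\<close>), so the distance to the root is the length of that path, and
  extending or shortening the path gives the distances of the neighbours: one neighbour is
  closer to the root and all others are farther away.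
\<close>

section \<open>Distances in graphs without long cycles\<close>

locale pair_acyclic_graph = pair_bidirected_digraph +
  assumes no_long_cycle: "cycle p \<Longrightarrow> length p < 3"
begin

text \<open>
  If two simple paths to \<open>v\<close> start with different arcs, follow the first one until it meets the
  second one at a vertex \<open>w\<close>, and return along the second one. This is a cycle, and it has
  length at least 3 because \<open>w\<close> cannot be the second vertex of both paths.
\<close>

lemma apath_unique:
  assumes "apath u p v" "apath u p' v"
  shows "p = p'"
  using assms
proof (induction p arbitrary: u p')
  case Nil
  then show ?case
    by (auto simp: apath_Nil_iff dest: apath_nonempty_ends)
next
  case (Cons e es)
  from Cons.prems have e: "e \<in> parcs G" "fst e = u" "apath (snd e) es v"
    "u \<notin> set (awalk_verts (snd e) es)"
    by (auto simp: apath_Cons_iff)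
  have uv: "u \<noteq> v"
    using Cons.prems(1) apath_nonempty_ends by blast
  then obtain e' es' where p': "p' = e' # es'"
    using Cons.prems(2) by (cases p') (auto simp: apath_Nil_iff)
  with Cons.prems(2) have e': "e' \<in> parcs G" "fst e' = u" "apath (snd e') es' v"
    by (auto simp: apath_Cons_iff)
  have "snd e = snd e'"
  proof (rule ccontr)
    assume ne: "snd e \<noteq> snd e'"
    let ?S = "set (awalk_verts u p')"
    have aw: "awalk (snd e) es v" "awalk u p' v"
      using e(3) Cons.prems(2) by (auto simp: apath_def)
    have "v \<in> set (awalk_verts (snd e) es)" "v \<in> ?S"
      using aw last_in_set[of "awalk_verts (snd e) es"] last_in_set[of "awalk_verts u p'"] by auto
    then have "\<exists>x\<in>set (awalk_verts (snd e) es). x \<in> ?S" by blast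
    then obtain xs w ys where w: "awalk_verts (snd e) es = xs @ w # ys" "w \<in> ?S"
      "\<forall>x\<in>set xs. x \<notin> ?S"
      by (rule split_list_first_propE)
    obtain q where q: "awalk (snd e) q w" "awalk_verts (snd e) q = xs @ [w]"
    proof -
      have "cas (snd e) es v" using aw by auto
      from awalk_decomp_verts[OF this w(1)] obtain q r where
        "cas (snd e) q w" "es = q @ r" "awalk_verts (snd e) q = xs @ [w]" by metis
      then show thesis using that[of q] aw by (auto simp: awalk_def)
    qed
    from w(2) obtain xs' ys' where w': "awalk_verts u p' = xs' @ w # ys'"
      by (auto dest: split_list)
    obtain q' r' where q': "awalk u q' w" "awalk_verts u q' = xs' @ [w]" "p' = q' @ r'"
    proof -
      have "cas u p' v" using aw by auto
      from awalk_decomp_verts[OF this w'] obtain q r where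
        "cas u q w" "p' = q @ r" "awalk_verts u q = xs' @ [w]" by metis
      then show thesis using that[of q r] aw by (auto simp: awalk_def)
    qed
    \<comment> \<open>The part \<open>q\<close> of the first path after \<open>e\<close> up to \<open>w\<close>, then the part \<open>q'\<close> of the second
      path up to \<open>w\<close> in reverse.\<close>
    let ?c = "e # q @ rev_path q'"
    have rev: "awalk w (rev_path q') u" "awalk_verts w (rev_path q') = w # rev xs'"
      using q' by (simp_all add: awalk_verts_rev_path)
    have c: "awalk u ?c u"
      using e q(1) rev(1) by (auto simp: awalk_Cons_iff awalk_def)
    have "awalk (snd e) (q @ rev_path q') u"
      using q(1) rev(1) by auto
    then have "tl (awalk_verts u ?c) = xs @ [w] @ rev xs'"
      using q rev by (simp add: awalk_verts_append)
    moreover have "distinct (xs @ [w] @ rev xs')"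
    proof -
      have "distinct (xs @ w # ys)" "distinct (xs' @ w # ys')"
        using e(3) Cons.prems(2) w(1) w' by (auto simp: apath_def)
      moreover have "set xs \<inter> set xs' = {}" using w(3) w' by auto
      ultimately show ?thesis by auto
    qed
    ultimately have "cycle ?c" using c by (auto simp: cycle_def)
    then have "length ?c < 3" by (rule no_long_cycle)
    have "w \<noteq> u" using w(1) e(4) by auto
    then have "q' \<noteq> []" using q'(1) by (auto simp: awalk_Nil_iff)
    have "length (rev_path q') = length q'"
      by (induction q') auto
    then have "q = []" "length q' = 1"
      using \<open>length ?c < 3\<close> \<open>q' \<noteq> []\<close> by (cases q; cases q'; auto)+
    then have "q' = [e']" "w = snd e"
      using p' q'(3) q(1) by (cases q'; auto simp: awalk_Nil_iff)+
    then show False using q'(1) ne by (auto simp: awalk_Cons_iff awalk_Nil_iff)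
  qed
  moreover have "e = e'" using e e' \<open>snd e = snd e'\<close> by (simp add: prod_eq_iff)
  ultimately show ?case using Cons.IH e(3) e'(3) p' by simp
qed

text \<open>Removing the detours of a walk leaves a simple path, hence the only one.\<close>

lemma apath_shortest:
  assumes "apath u p v" "awalk u p' v"
  shows "length p \<le> length p'"
proof -
  have "apath u (awalk_to_apath p') v" using assms(2) by (rule apath_awalk_to_apath)
  then have "p = awalk_to_apath p'" using assms(1) apath_unique by blast
  then have "set p \<subseteq> set p'" using awalk_to_apath_subset[OF assms(2)] by simp
  moreover have "distinct p"
    using assms(1) by (auto simp: apath_def intro: distinct_verts_imp_distinct)
  ultimately show ?thesis
    by (metis List.finite_set card_length card_mono distinct_card le_trans)
qed

lemma graph_dist_eqD:
  assumes "graph_dist G u v = ereal (real r)"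
  shows "\<exists>p. apath u p v \<and> length p = r"
proof -
  have cost: "awalk_cost (\<lambda>_. 1) p = real (length p)" for p
    by (induction p) auto
  have dist: "graph_dist G u v = (INF p\<in>{p. awalk u p v}. ereal (real (length p)))"
    by (simp add: graph_dist_def \<mu>_def cost)
  have "{p. awalk u p v} \<noteq> {}"
  proof
    assume "{p. awalk u p v} = {}"
    then have "graph_dist G u v = \<infinity>" unfolding dist by (simp add: top_ereal_def)
    then show False using assms by simp
  qed
  then obtain p' where "awalk u p' v" by auto
  then obtain p where p: "apath u p v" using apath_awalk_to_apath by blast
  have "(INF p\<in>{p. awalk u p v}. ereal (real (length p))) = ereal (real (length p))"
    using p apath_shortest[OF p]
    by (intro antisym INF_lower INF_greatest) (auto simp: apath_def)
  with dist assms p show ?thesis by (metis ereal.inject of_nat_eq_iff)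
qed

lemma neighbour_off_path:
  assumes "apath u p x" "(x, y) \<in> parcs G" "y \<notin> set (awalk_verts u p)"
  shows "apath u (p @ [(x, y)]) y"
  using assms by (auto simp: apath_append_iff apath_Cons_iff apath_Nil_iff apath_def awalk_simps
      awalk_verts_append wellformed')

text \<open>
  Cutting the path to \<open>x\<close> off at \<open>y\<close> and appending the arc from \<open>y\<close> to \<open>x\<close> gives a second simple
  path to \<open>x\<close>. It must be the path from the start, so \<open>y\<close> is the predecessor of \<open>x\<close>.
\<close>

lemma neighbour_on_path:
  assumes p: "apath u (p @ [(z, x)]) x" and y: "(x, y) \<in> parcs G"
    "y \<in> set (awalk_verts u (p @ [(z, x)]))"
  shows "y = z"
proof -
  let ?p = "p @ [(z, x)]"
  have "x \<noteq> y" using y(1) no_loops' by blast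
  have p': "awalk u p z" "awalk u ?p x"
    using p by (auto simp: apath_def awalk_simps)
  have verts: "awalk_verts u ?p = awalk_verts u p @ [x]"
    using p' by (simp add: awalk_verts_append)
  with y(2) \<open>x \<noteq> y\<close> have "y \<in> set (awalk_verts u p)" by auto
  then obtain q r where qr: "p = q @ r" "awalk u q y"
    using awalk_decomp[OF p'(1)] by metis
  have "x \<notin> set (awalk_verts u p)" "apath u p z"
    using p p' verts by (auto simp: apath_def)
  then have "apath u q y" "x \<notin> set (awalk_verts u q)"
    using qr p'(1) by (auto simp: apath_append_iff awalk_verts_append apath_def)
  then have "apath u (q @ [(y, x)]) x"
    using neighbour_off_path arcs_symmetric y(1) by blast
  from apath_unique[OF this p] show ?thesis by simp
qed

text \<open>
  The next two lemmas compute neighbour sums of a radial function. The function is radial in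
  the sense that its value at a vertex depends only on the length of the simple path to it;
  the neighbours of a vertex with such a path have one as well.
\<close>

lemma sum_neighbours_of_root:
  assumes "u \<in> pverts G"
    and f: "\<And>p y. apath u p y \<Longrightarrow> f y = F (length p)"
  shows "(\<Sum>y | (u, y) \<in> parcs G. f y) = real (card {y. (u, y) \<in> parcs G}) * F 1"
proof -
  have "f y = F 1" if "(u, y) \<in> parcs G" for y
  proof -
    have "apath u ([] @ [(u, y)]) y"
      using assms(1) that no_loops'[OF that]
      by (intro neighbour_off_path) (auto simp: apath_Nil_iff)
    from f[OF this] show ?thesis by simp
  qed
  then show ?thesis by simp
qed

lemma sum_neighbours:
  assumes p: "apath u p x" "p \<noteq> []"
    and fin: "finite {y. (x, y) \<in> parcs G}"
    and f: "\<And>p y. apath u p y \<Longrightarrow> f y = F (length p)"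
  shows "(\<Sum>y | (x, y) \<in> parcs G. f y) =
    F (length p - 1) + (real (card {y. (x, y) \<in> parcs G}) - 1) * F (length p + 1)"
proof -
  let ?N = "{y. (x, y) \<in> parcs G}"
  obtain p' z where "p = p' @ [(z, x)]"
  proof -
    obtain p' e where pe: "p = p' @ [e]" using p(2) by (metis rev_exhaust)
    with p(1) have "snd e = x" by (auto simp: apath_def awalk_simps)
    with pe show thesis using that[of p' "fst e"] by (metis prod.collapse)
  qed
  note p' = this
  have zN: "z \<in> ?N" using p(1) p' arcs_symmetric by (auto simp: apath_def awalk_simps)
  have "f z = F (length p - 1)"
  proof -
    have "apath u p' z"
      using p(1) p' by (auto simp: apath_def awalk_simps awalk_verts_append)
    from f[OF this] show ?thesis by (simp add: p')
  qed
  moreover have "f y = F (length p + 1)" if "y \<in> ?N - {z}" for y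
  proof -
    have "apath u (p @ [(x, y)]) y"
      using that p(1) neighbour_on_path[of u p' z x y] p'
      by (intro neighbour_off_path) auto
    from f[OF this] show ?thesis by simp
  qed
  moreover have "real (card (?N - {z})) = real (card ?N) - 1"
    using zN fin by (metis card_Suc_Diff1 diff_add_cancel of_nat_Suc add.commute add_diff_cancel_left')
  ultimately show ?thesis
    using sum.remove[OF fin zN, of f] by simp
qed

end

lemma regular_tree_acyclic:
  assumes "regular_tree k G"
  shows "pair_acyclic_graph G"
proof -
  interpret pair_sym_digraph G using assms by (simp add: regular_tree_def)
  interpret pair_loopfree_digraph G using assms by (simp add: regular_tree_def)
  show ?thesis
    using assms by unfold_locales (auto simp: regular_tree_def not_le[symmetric])
qed

lemma regular_tree_neighbours:
  assumes "regular_tree k G" "x \<in> pverts G"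
  shows "finite {y. (x, y) \<in> parcs G}" "card {y. (x, y) \<in> parcs G} = k"
proof -
  have out: "out_arcs (with_proj G) x = Pair x ` {y. (x, y) \<in> parcs G}"
    by (auto simp: out_arcs_def)
  have inj: "inj_on (Pair x) A" for A by (auto intro: inj_onI)
  have deg: "finite (out_arcs (with_proj G) x)" "card (out_arcs (with_proj G) x) = k"
    using assms by (auto simp: regular_tree_def out_degree_def)
  show "finite {y. (x, y) \<in> parcs G}" "card {y. (x, y) \<in> parcs G} = k"
    using deg unfolding out by (simp_all add: card_image[OF inj] finite_image_iff[OF inj])
qed

section \<open>The radial form of the wave equation\<close>

text \<open>
  This is the operator \<open>P - s\<close> on functions of the distance \<open>n\<close> to the root.
\<close>

definition radial_step :: "nat \<Rightarrow> real \<Rightarrow> (nat \<Rightarrow> real) \<Rightarrow> nat \<Rightarrow> real" where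
  "radial_step q s F n =
     (if n = 0 then F 1 else (F (n - 1) + real q * F (n + 1)) / (real q + 1)) - s * F n"

text \<open>The value of \<open>(P - s)^k \<delta>\<close> at distance \<open>n\<close>, where \<open>\<delta>\<close> is the point mass at the root.\<close>

primrec radial_power :: "nat \<Rightarrow> real \<Rightarrow> nat \<Rightarrow> nat \<Rightarrow> real" where
  "radial_power q s 0 = (\<lambda>n. if n = 0 then 1 else 0)"
| "radial_power q s (Suc k) = radial_step q s (radial_power q s k)"

text \<open>
  The Taylor expansion in time, with the binomial coefficients as the discrete analogues of
  \<open>t^(2k) / (2k)!\<close>. The summands with \<open>2k > t\<close> are 0, so any range that contains \<open>k \<le> t/2\<close> gives
  the same function.
\<close>

definition wave_profile :: "nat \<Rightarrow> real \<Rightarrow> nat \<Rightarrow> nat \<Rightarrow> real" where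
  "wave_profile q s t n = (\<Sum>k\<le>t. real (t choose (2 * k)) * radial_power q s k n)"

lemma radial_step_sum:
  "radial_step q s (\<lambda>n. \<Sum>k\<in>A. c k * F k n) n = (\<Sum>k\<in>A. c k * radial_step q s (F k) n)"
  by (simp add: radial_step_def sum_distrib_left sum_divide_distrib sum.distrib[symmetric]
      sum_subtractf[symmetric] algebra_simps add_divide_distrib)

lemma wave_profile_extend:
  assumes "t \<le> N"
  shows "wave_profile q s t n = (\<Sum>k\<le>N. real (t choose (2 * k)) * radial_power q s k n)"
  unfolding wave_profile_def
  using assms by (intro sum.mono_neutral_left) (auto simp: binomial_eq_0)

lemma binomial_diff2:
  "real (t + 2 choose (j + 2)) - 2 * real (t + 1 choose (j + 2)) + real (t choose (j + 2))
    = real (t choose j)"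
  by (simp add: numeral_2_eq_2)

text \<open>
  The second difference lowers the index of the binomial coefficient by 2, which leaves one
  surplus application of \<open>P - s\<close> in every summand.
\<close>

lemma wave_profile_diff2:
  "diff2 (\<lambda>t. wave_profile q s t n) t = radial_step q s (wave_profile q s t) n"
proof -
  let ?u = "\<lambda>k. radial_power q s k n"
  define g where "g k = (real (t + 2 choose (2 * k)) - 2 * real (t + 1 choose (2 * k))
    + real (t choose (2 * k))) * ?u k" for k
  have "diff2 (\<lambda>t. wave_profile q s t n) t = (\<Sum>k\<le>t + 2. g k)"
    by (simp add: g_def diff2_def wave_profile_extend[of _ "t + 2"] sum_distrib_left
        sum.distrib[symmetric] sum_subtractf[symmetric] algebra_simps)
  also have "\<dots> = g 0 + (\<Sum>k\<le>t + 1. g (Suc k))"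
    using sum.atMost_Suc_shift[of g "t + 1"] by simp
  also have "\<dots> = (\<Sum>k\<le>t + 1. real (t choose (2 * k)) * ?u (Suc k))"
  proof -
    have "g (Suc k) = real (t choose (2 * k)) * ?u (Suc k)" for k
      unfolding g_def binomial_diff2[of t "2 * k", symmetric] by simp
    then show ?thesis by (simp add: g_def)
  qed
  also have "\<dots> = radial_step q s (wave_profile q s t) n"
  proof -
    have "wave_profile q s t
        = (\<lambda>n. \<Sum>k\<le>t + 1. real (t choose (2 * k)) * radial_power q s k n)"
      using wave_profile_extend[of t "t + 1"] by (intro ext) simp
    then show ?thesis by (simp only: radial_step_sum radial_power.simps)
  qed
  finally show ?thesis .
qed

text \<open>
  The wave equation expresses the values at time \<open>t + 2\<close> by those at times \<open>t\<close> and \<open>t + 1\<close>. The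
  profile obeys the same recursion with the same initial values, hence the induction over two
  consecutive times.
\<close>

lemma wave_kernel_eq_profile:
  assumes tree: "regular_tree (q + 1) G"
    and "x0 \<in> pverts G"
    and W: "is_wave_kernel q (1 - s) (1 / (real q + 1)) G x0 W"
    and p: "pre_digraph.apath (with_proj G) x0 p x"
  shows "W x t = wave_profile q s t (length p)"
proof -
  interpret pair_acyclic_graph G using tree by (rule regular_tree_acyclic)
  have verts: "y \<in> pverts G" if "apath x0 p y" for p y
    using that by (auto simp: apath_def dest: awalk_last_in_verts)
  have init: "W y 0 = wave_profile q s 0 (length p)" "W y 1 = wave_profile q s 1 (length p)"
    if "apath x0 p y" for p y
  proof -
    have y: "W y 0 = (if y = x0 then 1 else 0)" "W y 1 = W y 0"
      using W verts[OF that] by (auto simp: is_wave_kernel_def diff1_def)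
    have "y = x0 \<longleftrightarrow> p = []"
      using that by (auto simp: apath_Nil_iff dest: apath_nonempty_ends)
    with y show "W y 0 = wave_profile q s 0 (length p)" "W y 1 = wave_profile q s 1 (length p)"
      by (auto simp: wave_profile_def)
  qed
  have "\<forall>y p. apath x0 p y \<longrightarrow> W y t = wave_profile q s t (length p)
      \<and> W y (t + 1) = wave_profile q s (t + 1) (length p)"
  proof (induction t)
    case 0
    then show ?case using init by simp
  next
    case (Suc t)
    show ?case
    proof (intro allI impI)
      fix y p assume p: "apath x0 p y"
      let ?F = "wave_profile q s t"
      have IH: "W z t = ?F (length p)" if "apath x0 p z" for p z
        using Suc that by blast
      have y: "y \<in> pverts G" using p by (rule verts)
      note N = regular_tree_neighbours[OF tree y]
      have mean: "(\<Sum>z | (y, z) \<in> parcs G. W z t) / (real q + 1)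
          = radial_step q s ?F (length p) + s * ?F (length p)"
      proof (cases "p = []")
        case True
        with p have "y = x0" by (auto simp: apath_Nil_iff)
        with N sum_neighbours_of_root[where f = "\<lambda>z. W z t" and F = ?F, OF y IH] True show ?thesis
          by (simp add: radial_step_def add.commute[of 1])
      next
        case False
        with N sum_neighbours[where f = "\<lambda>z. W z t" and F = ?F, OF p False N(1) IH] show ?thesis
          by (simp add: radial_step_def)
      qed
      have "scaled_laplacian q (1 - s) (1 / (real q + 1)) G (\<lambda>z. W z t) y + diff2 (W y) t = 0"
        using W y by (simp add: is_wave_kernel_def)
      then have "diff2 (W y) t = (\<Sum>z | (y, z) \<in> parcs G. W z t) / (real q + 1) - s * W y t"
        by (simp add: scaled_laplacian_def tree_laplacian_def field_simps)
      also have "\<dots> = diff2 (\<lambda>t. wave_profile q s t (length p)) t"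
        by (simp add: mean IH[OF p] wave_profile_diff2)
      finally have "diff2 (W y) t = diff2 (\<lambda>t. wave_profile q s t (length p)) t" .
      moreover have "W y t = ?F (length p)" "W y (t + 1) = wave_profile q s (t + 1) (length p)"
        using Suc p by blast+
      ultimately show "W y (Suc t) = wave_profile q s (Suc t) (length p)
          \<and> W y (Suc t + 1) = wave_profile q s (Suc t + 1) (length p)"
        by (simp add: diff2_def)
    qed
  qed
  with p show ?thesis by blast
qed

section \<open>Size of the terms of the expansion\<close>

lemma radial_power_eq_0:
  "k < n \<Longrightarrow> radial_power q s k n = 0"
  by (induction k arbitrary: n) (auto simp: radial_step_def)

lemma radial_power_diag:
  "radial_power q s n n = 1 / (real q + 1) ^ n"
  by (induction n) (auto simp: radial_step_def radial_power_eq_0)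

text \<open>
  With \<open>h = q^(-1/2)\<close>, the three parts of a step contribute to index \<open>k + 1\<close> at distance \<open>n\<close>:
  the value at distance \<open>n - 1\<close> is of order \<open>h^(k + n - 1)\<close> and gains \<open>1/(q + 1) \<le> h\<^sup>2\<close>,
  the value at distance \<open>n + 1\<close> is of order \<open>h^(k + n + 1)\<close> already, and the value at distance
  \<open>n\<close> is of order \<open>h^(k + n)\<close> and gains \<open>\<bar>s\<bar> \<le> 2 h\<close>. The constants add up to 4.
\<close>

lemma radial_power_bound:
  fixes q :: nat
  defines "h \<equiv> 1 / sqrt (real q)"
  assumes q: "q \<ge> 1" and s: "\<bar>s\<bar> \<le> 2 * h"
  shows "\<bar>radial_power q s k n\<bar> \<le> 4 ^ k * h ^ (k + n)"
proof (induction k arbitrary: n)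
  case 0
  have "0 \<le> h" by (simp add: h_def)
  then show ?case by simp
next
  case (Suc k)
  let ?u = "radial_power q s k" and ?B = "4 ^ k * h ^ (k + n + 1)"
  have h: "0 < h" "h\<^sup>2 = 1 / real q" using q by (auto simp: h_def power_divide)
  have stay: "\<bar>s * ?u n\<bar> \<le> 2 * ?B"
  proof -
    have "\<bar>s * ?u n\<bar> \<le> (2 * h) * (4 ^ k * h ^ (k + n))"
      unfolding abs_mult using s Suc h by (intro mult_mono) auto
    then show ?thesis by (simp add: algebra_simps)
  qed
  have "\<bar>if n = 0 then ?u 1 else (?u (n - 1) + real q * ?u (n + 1)) / (real q + 1)\<bar> \<le> 2 * ?B"
  proof (cases "n = 0")
    case True
    then show ?thesis using Suc[of 1] h by simp
  next
    case False
    have down: "\<bar>?u (n - 1) / (real q + 1)\<bar> \<le> ?B"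
    proof -
      have "\<bar>?u (n - 1) / (real q + 1)\<bar> = \<bar>?u (n - 1)\<bar> * (1 / (real q + 1))" by simp
      also have "\<dots> \<le> (4 ^ k * h ^ (k + (n - 1))) * h\<^sup>2"
        unfolding h(2) using q h(1) by (intro mult_mono Suc) (auto simp: field_simps)
      also have "\<dots> = 4 ^ k * h ^ (k + (n - 1) + 2)" by (simp only: power_add mult.assoc)
      also have "k + (n - 1) + 2 = k + n + 1" using False by simp
      finally show ?thesis .
    qed
    have up: "\<bar>real q * ?u (n + 1) / (real q + 1)\<bar> \<le> ?B"
    proof -
      have "\<bar>real q * ?u (n + 1) / (real q + 1)\<bar> = \<bar>?u (n + 1)\<bar> * (real q / (real q + 1))"
        by (simp add: abs_mult)
      also have "\<dots> \<le> (4 ^ k * h ^ (k + (n + 1))) * 1"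
        using h(1) by (intro mult_mono Suc) auto
      finally show ?thesis by (simp add: add.assoc)
    qed
    have "\<bar>(?u (n - 1) + real q * ?u (n + 1)) / (real q + 1)\<bar> \<le> ?B + ?B"
      unfolding add_divide_distrib
      by (rule order_trans[OF abs_triangle_ineq add_mono[OF down up]])
    then show ?thesis using False by (simp add: mult_ac)
  qed
  with stay have "\<bar>radial_power q s (Suc k) n\<bar> \<le> 2 * ?B + 2 * ?B"
    unfolding radial_power.simps radial_step_def by linarith
  then show ?case by (simp add: algebra_simps)
qed

section \<open>The relative error\<close>

definition relative_error :: "nat \<Rightarrow> nat \<Rightarrow> nat \<Rightarrow> real \<Rightarrow> real" where
  "relative_error r t q s = (\<Sum>k\<in>{r<..t}. real (t choose (2 * k)) * radial_power q s k r)
     * (real q + 1) ^ r / real (t choose (2 * r))"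

lemma wave_profile_eq_leading_term:
  assumes "2 * r \<le> t"
  shows "wave_profile q s t r =
    real (t choose (2 * r)) / (real q + 1) ^ r * (1 + relative_error r t q s)"
proof -
  let ?g = "\<lambda>k. real (t choose (2 * k)) * radial_power q s k r"
  have "wave_profile q s t r = sum ?g {r..t}"
    unfolding wave_profile_def
    by (intro sum.mono_neutral_right) (auto simp: radial_power_eq_0)
  also have "\<dots> = ?g r + sum ?g {r<..t}"
    using assms sum.head[of r t ?g] by simp
  finally have "wave_profile q s t r = ?g r + sum ?g {r<..t}" .
  moreover have "real (t choose (2 * r)) / (real q + 1) ^ r * relative_error r t q s
      = sum ?g {r<..t}"
    using assms by (simp add: relative_error_def)
  ultimately show ?thesis by (simp add: radial_power_diag distrib_left)
qed

text \<open>
  Each summand is at most a constant times \<open>h^(k + r) (q + 1)^r\<close> with \<open>h = q^(-1/2)\<close>. As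
  \<open>q + 1 \<le> 2 h^(-2)\<close>, this is at most \<open>2^r h^(k - r)\<close>, and \<open>h^(k - r) \<le> h\<close> for \<open>k > r\<close>.
\<close>

lemma relative_error_bound:
  assumes "q \<ge> 1" "\<bar>s\<bar> \<le> 2 / sqrt (real q)" "2 * r \<le> t"
  shows "\<bar>relative_error r t q s\<bar>
    \<le> (\<Sum>k\<in>{r<..t}. real (t choose (2 * k)) * 4 ^ k * 2 ^ r) * (1 / sqrt (real q))"
proof -
  define h where "h = 1 / sqrt (real q)"
  have h: "0 < h" "h \<le> 1" "h\<^sup>2 = 1 / real q"
    using assms(1) by (auto simp: h_def power_divide)
  have u: "\<bar>radial_power q s k r\<bar> * (real q + 1) ^ r \<le> 4 ^ k * 2 ^ r * h"
    if "r < k" for k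
  proof -
    have "\<bar>radial_power q s k r\<bar> * (real q + 1) ^ r \<le> (4 ^ k * h ^ (k + r)) * (2 * real q) ^ r"
      using radial_power_bound[of q s k r] assms(1,2) h
      by (intro mult_mono power_mono) (auto simp: h_def)
    also have "(2 * real q) ^ r = 2 ^ r / h ^ (2 * r)"
      using h assms(1) by (simp add: power_mult power_mult_distrib power_divide)
    also have "h ^ (k + r) = h ^ (k - r - 1) * h * h ^ (2 * r)"
    proof -
      have "k + r = (k - r - 1) + 1 + 2 * r" using that by simp
      then show ?thesis by (simp only: power_add power_one_right)
    qed
    also have "(4 ^ k * (h ^ (k - r - 1) * h * h ^ (2 * r))) * (2 ^ r / h ^ (2 * r))
        = 4 ^ k * 2 ^ r * h * h ^ (k - r - 1)"
      using h by simp
    also have "\<dots> \<le> 4 ^ k * 2 ^ r * h * 1"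
      using h by (intro mult_left_mono power_le_one) auto
    finally show ?thesis by simp
  qed
  let ?X = "\<bar>\<Sum>k\<in>{r<..t}. real (t choose (2 * k)) * radial_power q s k r\<bar> * (real q + 1) ^ r"
  have C: "real (t choose (2 * r)) \<ge> 1"
    using assms(3) by (simp add: Suc_leI)
  have "?X \<le> ?X * real (t choose (2 * r))"
    using mult_left_mono[OF C, of ?X] by simp
  with C have "?X / real (t choose (2 * r)) \<le> ?X"
    by (simp add: divide_le_eq)
  then have "\<bar>relative_error r t q s\<bar>
\<le> ?X"
    by (simp add: relative_error_def abs_mult)
  also have "\<dots> \<le> (\<Sum>k\<in>{r<..t}. \<bar>real (t choose (2 * k)) * radial_power q s k r\<bar>) * (real q + 1) ^ r"
    by (intro mult_right_mono sum_abs) auto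
  also have "\<dots> = (\<Sum>k\<in>{r<..t}. real (t choose (2 * k)) * (\<bar>radial_power q s k r\<bar> * (real q + 1) ^ r))"
    by (simp add: sum_distrib_right abs_mult mult.assoc)
  also have "\<dots> \<le> (\<Sum>k\<in>{r<..t}. real (t choose (2 * k)) * (4 ^ k * 2 ^ r * h))"
    by (intro sum_mono mult_left_mono u) auto
  finally show ?thesis unfolding sum_distrib_right h_def by (simp only: mult.assoc)
qed

theorem corollary6p5:
  fixes T :: "nat \<Rightarrow> 'v pair_pre_digraph"
    and x0 :: "nat \<Rightarrow> 'v"
    and W :: "nat \<Rightarrow> 'v \<Rightarrow> nat \<Rightarrow> real"
    and r t :: nat
  assumes tree: "\<And>q. q \<ge> 1 \<Longrightarrow> regular_tree (q + 1) (T q)"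
    and root: "\<And>q. q \<ge> 1 \<Longrightarrow> x0 q \<in> pverts (T q)"
    and kernel: "\<And>q. q \<ge> 1 \<Longrightarrow>
      is_wave_kernel q (1 - 2 * sqrt (real q) / (real q + 1)) (1 / (real q + 1)) (T q) (x0 q) (W q)"
    and "t \<ge> 2 * r"
  shows "\<exists>\<epsilon> :: nat \<Rightarrow> real. \<epsilon> \<in> O[at_top](\<lambda>q. 1 / sqrt (real q)) \<and>
    (\<forall>q \<ge> 1. \<forall>x \<in> pverts (T q). graph_dist (T q) (x0 q) x = ereal (real r) \<longrightarrow>
      W q x t = real (t choose (2 * r)) * (real q + 1) powi (- int r) * (1 + \<epsilon> q))"
proof -
  define s where "s q = 2 * sqrt (real q) / (real q + 1)" for q :: nat
  define \<epsilon> where "\<epsilon> q = relative_error r t q (s q)" for q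
  have s: "\<bar>s q\<bar> \<le> 2 / sqrt (real q)" if "q \<ge> 1" for q
  proof -
    have "s q \<le> 2 * sqrt (real q) / real q"
      unfolding s_def using that by (intro divide_left_mono) auto
    also have "\<dots> = 2 / sqrt (real q)"
      using sqrt_divide_self_eq[of "real q"] by (simp add: divide_inverse mult.assoc)
    finally show ?thesis by (simp add: s_def)
  qed
  have "\<epsilon> \<in> O[at_top](\<lambda>q. 1 / sqrt (real q))"
  proof (rule bigoI)
    show "\<forall>\<^sub>F q in at_top. norm (\<epsilon> q)
      \<le> (\<Sum>k\<in>{r<..t}. real (t choose (2 * k)) * 4 ^ k * 2 ^ r) * norm (1 / sqrt (real q))"
      using eventually_ge_at_top[of 1]
      by eventually_elim (use relative_error_bound[OF _ s \<open>t \<ge> 2 * r\<close>] in \<open>simp add: \<epsilon>_def\<close>)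
  qed
  moreover have "W q x t = real (t choose (2 * r)) * (real q + 1) powi (- int r) * (1 + \<epsilon> q)"
    if q: "q \<ge> 1" and dist: "graph_dist (T q) (x0 q) x = ereal (real r)" for q x
  proof -
    interpret pair_acyclic_graph "T q" using tree[OF q] by (rule regular_tree_acyclic)
    obtain p where p: "apath (x0 q) p x" "length p = r"
      using graph_dist_eqD[OF dist] by blast
    have "W q x t = wave_profile q (s q) t r"
      using wave_kernel_eq_profile[OF tree[OF q] root[OF q] _ p(1)] kernel[OF q] p(2)
      by (simp add: s_def)
    also have "\<dots> = real (t choose (2 * r)) * (real q + 1) powi (- int r) * (1 + \<epsilon> q)"
      using wave_profile_eq_leading_term[OF \<open>t \<ge> 2 * r\<close>]
      by (simp add: \<epsilon>_def power_int_minus divide_inverse)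
    finally show ?thesis .
  qed
  ultimately show ?thesis by blast
qed

end
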